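(* Let $V$ be a countable set, $u\ge2$, and let $\pi_{u-1}$ and $\pi_u$ be two positive finite measures on $V$. Let $K_u$ be a Markov transition operator on $V$ with invariant measure $\pi_u$. Assume that $\pi_u(x)\ge\pi_{u-1}(x)$ for all $x\in V$. Let $K_u^*$ be the dual of $K_u:\ell^2(\pi_u)\to\ell^2(\pi_u)$ and $K_u^{\Rightarrow}:\ell^2(\pi_{u-1})\to\ell^2(\pi_u)$ the dual of $K_u:\ell^2(\pi_u)\to\ell^2(\pi_{u-1})$. Then $$\forall a,b\in[1,\infty],\quad\left\|K_u^{\Rightarrow}\right\|_{\ell^a(\pi_{u-1})\to\ell^b(\pi_u)}\le\left\|K_u^*\right\|_{\ell^a(\pi_u)\to\ell^b(\pi_u)}.$$
   Context: A Markov transition operator $K$ on $V$ is a map $K:V\times V\to[0,1]$ with $\sum_y K(x,y)=1$ for all $x$; $(Kf)(x)=\sum_yK(x,y)f(y)$; $\pi$ is invariant for $K$ if $\sum_x\pi(x)K(x,y)=\pi(y)$ for all $y$. Positive means $\pi(x)>0$ for all $x$. Norms: $\|f\|_{\ell^p(\pi)}=(\sum_x|f(x)|^p\pi(x))^{1/p}$ for $p<\infty$, $\|f\|_{\ell^\infty(\pi)}=\sup_x|f(x)|$; operator norms take values in $[0,+\infty]$. The duals are given by the kernels $K_u^*(x,y)=\frac{\pi_u(y)}{\pi_u(x)}K_u(y,x)$ and $K_u^{\Rightarrow}(x,y)=\frac{\pi_{u-1}(y)}{\pi_u(x)}K_u(y,x)$, acting on functions by $f\mapsto\sum_yK_u^*(\cdot,y)f(y)$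 and $f\mapsto\sum_yK_u^{\Rightarrow}(\cdot,y)f(y)$; in particular $\langle K_uf,g\rangle_{\pi_{u-1}}=\langle f,K_u^{\Rightarrow}g\rangle_{\pi_u}$ for $f\in\ell^2(\pi_u)$, $g\in\ell^2(\pi_{u-1})$, where $\langle f,g\rangle_\pi=\sum_xf(x)g(x)\pi(x)$. *)

theory Defs
  imports "HOL-Analysis.Analysis"
begin

text \<open>The countable state space is a carrier set \<open>V\<close>. A measure on \<open>V\<close> is given by its point masses;
  all definitions depend only on the values of functions, measures and kernels on \<open>V\<close>.\<close>

definition positive_finite_measure :: "'a set \<Rightarrow> ('a \<Rightarrow> real) \<Rightarrow> bool" where
  "positive_finite_measure V \<mu> \<longleftrightarrow> (\<forall>x\<in>V. \<mu> x > 0) \<and> \<mu> summable_on V"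

definition markov_operator :: "'a set \<Rightarrow> ('a \<Rightarrow> 'a \<Rightarrow> real) \<Rightarrow> bool" where
  "markov_operator V K \<longleftrightarrow>
     (\<forall>x\<in>V. \<forall>y\<in>V. K x y \<in> {0..1}) \<and> (\<forall>x\<in>V. ((\<lambda>y. K x y) has_sum 1) V)"

definition invariant_measure :: "'a set \<Rightarrow> ('a \<Rightarrow> real) \<Rightarrow> ('a \<Rightarrow> 'a \<Rightarrow> real) \<Rightarrow> bool" where
  "invariant_measure V \<mu> K \<longleftrightarrow> (\<forall>y\<in>V. ((\<lambda>x. \<mu> x * K x y) has_sum \<mu> y) V)"

definition kernel_op :: "'a set \<Rightarrow> ('a \<Rightarrow> 'a \<Rightarrow> real) \<Rightarrow> ('a \<Rightarrow> real) \<Rightarrow> 'a \<Rightarrow> real" where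
  "kernel_op V K f x = (\<Sum>\<^sub>\<infinity>y\<in>V. K x y * f y)"

text \<open>\<open>dual_kernel \<nu> \<mu> K\<close> is the kernel of the dual \<open>\<ell>\<^sup>2(\<nu>) \<rightarrow> \<ell>\<^sup>2(\<mu>)\<close> of
  \<open>K : \<ell>\<^sup>2(\<mu>) \<rightarrow> \<ell>\<^sup>2(\<nu>)\<close>. Thus \<open>K\<^sub>u\<^sup>*\<close> is the case \<open>\<nu> = \<mu> = \<pi>\<^sub>u\<close>, and
  \<open>K\<^sub>u\<^sup>\<Rightarrow>\<close> the case \<open>\<nu> = \<pi>\<^sub>u\<^sub>-\<^sub>1\<close>, \<open>\<mu> = \<pi>\<^sub>u\<close>.\<close>

definition dual_kernel ::
  "('a \<Rightarrow> real) \<Rightarrow> ('a \<Rightarrow> real) \<Rightarrow> ('a \<Rightarrow> 'a \<Rightarrow> real) \<Rightarrow> 'a \<Rightarrow> 'a \<Rightarrow> real" where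
  "dual_kernel \<nu> \<mu> K x y = \<nu> y / \<mu> x * K y x"

text \<open>The \<open>\<ell>\<^sup>p\<close> norm takes the value \<open>\<infinity>\<close> exactly on functions outside \<open>\<ell>\<^sup>p(\<mu>)\<close>.\<close>

definition lp_norm :: "'a set \<Rightarrow> ('a \<Rightarrow> real) \<Rightarrow> ennreal \<Rightarrow> ('a \<Rightarrow> real) \<Rightarrow> ennreal" where
  "lp_norm V \<mu> p f =
     (if p = \<infinity> then (SUP x\<in>V. ennreal \<bar>f x\<bar>)
      else if (\<lambda>x. \<bar>f x\<bar> powr enn2real p * \<mu> x) summable_on V
      then ennreal ((\<Sum>\<^sub>\<infinity>x\<in>V. \<bar>f x\<bar> powr enn2real p * \<mu> x) powr (1 / enn2real p))
      else \<infinity>)"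

text \<open>For a dual kernel of a Markov operator with respect to finite measures \<open>\<nu>\<close>, \<open>\<mu>\<close> and \<open>a \<ge> 1\<close>,
  \<open>\<ell>\<^sup>a(\<nu>) \<subseteq> \<ell>\<^sup>1(\<nu>)\<close>, so the sums in \<open>kernel_op\<close> converge absolutely for all \<open>f\<close> in the
  supremum below.\<close>

definition op_norm ::
  "'a set \<Rightarrow> ('a \<Rightarrow> real) \<Rightarrow> ennreal \<Rightarrow> ('a \<Rightarrow> real) \<Rightarrow> ennreal
    \<Rightarrow> (('a \<Rightarrow> real) \<Rightarrow> ('a \<Rightarrow> real)) \<Rightarrow> ennreal" where
  "op_norm V \<nu> a \<mu> b T = (SUP f\<in>{f. lp_norm V \<nu> a f \<le> 1}. lp_norm V \<mu> b (T f))"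

end

theory Submission
  imports Defs
begin

text \<open>With the density \<open>h = \<pi>\<^sub>u\<^sub>-\<^sub>1 / \<pi>\<^sub>u \<le> 1\<close> one has \<open>K\<^sub>u\<^sup>\<Rightarrow> f = K\<^sub>u\<^sup>* (h f)\<close>, and
  \<open>f \<mapsto> h f\<close> is a contraction from \<open>\<ell>\<^sup>a(\<pi>\<^sub>u\<^sub>-\<^sub>1)\<close> to \<open>\<ell>\<^sup>a(\<pi>\<^sub>u)\<close>,
  because \<open>h\<^sup>a \<pi>\<^sub>u \<le> h \<pi>\<^sub>u = \<pi>\<^sub>u\<^sub>-\<^sub>1\<close> for \<open>a \<ge> 1\<close>.\<close>

text \<open>The factor \<open>\<mu> y\<close> cancels inside each summand, so both sides sum the
  same function of \<open>y\<close>, whatever \<open>f\<close> is.\<close>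

lemma kernel_op_dual_kernel_density:
  assumes "\<And>y. y \<in> V \<Longrightarrow> \<mu> y \<noteq> 0"
  shows "kernel_op V (dual_kernel \<nu> \<mu> K) f = kernel_op V (dual_kernel \<mu> \<mu> K) (\<lambda>y. \<nu> y / \<mu> y * f y)"
  unfolding kernel_op_def dual_kernel_def using assms by (auto intro!: ext infsum_cong)

lemma lp_norm_density_le:
  assumes pos: "\<And>x. x \<in> V \<Longrightarrow> 0 < \<nu> x" and le: "\<And>x. x \<in> V \<Longrightarrow> \<nu> x \<le> \<mu> x" and "1 \<le> a"
  shows "lp_norm V \<mu> a (\<lambda>x. \<nu> x / \<mu> x * f x) \<le> lp_norm V \<nu> a f"
proof -
  have h: "0 < \<nu> x / \<mu> x" "\<nu> x / \<mu> x \<le> 1" "\<mu> x > 0" if "x \<in> V" for x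
    using pos[OF that] le[OF that] by (auto simp: divide_simps)
  show ?thesis
  proof (cases "a = \<infinity>")
    case True
    have "\<bar>\<nu> x / \<mu> x * f x\<bar> \<le> \<bar>f x\<bar>" if "x \<in> V" for x
      using mult_right_mono[OF h(2)[OF that], of "\<bar>f x\<bar>"] h(1)[OF that] by (simp only: abs_mult abs_of_pos mult_1_left abs_ge_zero)
    then show ?thesis
      using True by (auto simp: lp_norm_def intro!: SUP_mono ennreal_leI)
  next
    case False
    define p where "p = enn2real a"
    \<comment> \<open>Finiteness of \<open>a\<close> matters here, since \<open>enn2real\<close>
      sends \<open>\<infinity>\<close> to 0.\<close>
    have "1 \<le> p"
      using \<open>1 \<le> a\<close> False unfolding p_def by (cases a) auto
    define F where "F = (\<lambda>x. \<bar>\<nu> x / \<mu> x * f x\<bar> powr p * \<mu> x)"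
    define G where "G = (\<lambda>x. \<bar>f x\<bar> powr p * \<nu> x)"
    have FG: "0 \<le> F x" "F x \<le> G x" if "x \<in> V" for x
    proof -
      \<comment> \<open>Powers of a base in (0,1] decrease in the exponent; this is compared with
        exponent 1.\<close>
      have "(\<nu> x / \<mu> x) powr p \<le> \<nu> x / \<mu> x"
        using powr_mono'[OF \<open>1 \<le> p\<close>, of "\<nu> x / \<mu> x"] h[OF that] by simp
      then have "(\<nu> x / \<mu> x) powr p * \<mu> x \<le> \<nu> x"
        using h(3)[OF that] by (simp add: field_simps)
      then have "\<bar>f x\<bar> powr p * ((\<nu> x / \<mu> x) powr p * \<mu> x) \<le> \<bar>f x\<bar> powr p * \<nu> x"
        by (rule mult_left_mono) simp
      moreover have "F x = \<bar>f x\<bar> powr p * ((\<nu> x / \<mu> x) powr p * \<mu> x)"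
        using h(1)[OF that] unfolding F_def by (simp only: abs_mult powr_mult abs_of_pos ac_simps)
      ultimately show "F x \<le> G x" by (simp add: G_def)
      show "0 \<le> F x" using h(3)[OF that] by (simp add: F_def)
    qed
    show ?thesis
    \<comment> \<open>If \<open>G\<close> is summable, then so is its minorant \<open>F\<close>, and
      both norms are given by their sums. Otherwise the right-hand norm is
      \<open>\<infinity>\<close>.\<close>
    proof (cases "G summable_on V")
      case True
      then have "F summable_on V"
        by (rule summable_on_comparison_test) (use FG in auto)
      moreover have "infsum F V \<le> infsum G V"
        using \<open>F summable_on V\<close> True FG(2) by (rule infsum_mono)
      moreover have "0 \<le> infsum F V"
        using FG(1) by (rule infsum_nonneg)
      ultimately show ?thesis
        using True False \<open>1 \<le> p\<close>
        by (simp add: lp_norm_def F_def G_def flip: p_def) (intro ennreal_leI powr_mono2, auto)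
    next
      case False
      then show ?thesis
        using \<open>a \<noteq> \<infinity>\<close> by (simp add: lp_norm_def G_def p_def)
    qed
  qed
qed

theorem lemma3p17:
  fixes V :: "'a set" and u :: nat
    and \<pi> :: "nat \<Rightarrow> 'a \<Rightarrow> real" and K :: "nat \<Rightarrow> 'a \<Rightarrow> 'a \<Rightarrow> real"
  assumes "countable V"
    and "u \<ge> 2"
    and "positive_finite_measure V (\<pi> (u - 1))"
    and "positive_finite_measure V (\<pi> u)"
    and "markov_operator V (K u)"
    and "invariant_measure V (\<pi> u) (K u)"
    and "\<forall>x\<in>V. \<pi> u x \<ge> \<pi> (u - 1) x"
  shows "\<forall>a b :: ennreal. 1 \<le> a \<longrightarrow> 1 \<le> b \<longrightarrow>
     op_norm V (\<pi> (u - 1)) a (\<pi> u) b (kernel_op V (dual_kernel (\<pi> (u - 1)) (\<pi> u) (K u)))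
       \<le> op_norm V (\<pi> u) a (\<pi> u) b (kernel_op V (dual_kernel (\<pi> u) (\<pi> u) (K u)))"
proof (intro allI impI)
  fix a b :: ennreal assume "1 \<le> a"
  let ?h = "\<lambda>f x. \<pi> (u - 1) x / \<pi> u x * f x"
  have pos: "\<pi> (u - 1) x > 0" "\<pi> u x > 0" if "x \<in> V" for x
    using assms(3,4) that by (auto simp: positive_finite_measure_def)
  \<comment> \<open>\<open>?h\<close> maps one unit ball into the other, so \<open>?h f\<close> is
    an admissible competitor in the right-hand supremum.\<close>
  have "lp_norm V (\<pi> u) a (?h f) \<le> 1" if "lp_norm V (\<pi> (u - 1)) a f \<le> 1" for f
    using assms(7) pos(1) \<open>1 \<le> a\<close> by (intro order_trans[OF lp_norm_density_le that]) auto
  moreover have "kernel_op V (dual_kernel (\<pi> (u - 1)) (\<pi> u) (K u)) f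
      = kernel_op V (dual_kernel (\<pi> u) (\<pi> u) (K u)) (?h f)" for f
    using pos(2) by (intro kernel_op_dual_kernel_density) force
  \<comment> \<open>The value at \<open>f\<close> on the left is the value at \<open>?h f\<close> on
    the right, measured in the same target norm.\<close>
  ultimately show "op_norm V (\<pi> (u - 1)) a (\<pi> u) b (kernel_op V (dual_kernel (\<pi> (u - 1)) (\<pi> u) (K u)))
       \<le> op_norm V (\<pi> u) a (\<pi> u) b (kernel_op V (dual_kernel (\<pi> u) (\<pi> u) (K u)))"
    unfolding op_norm_def by (intro SUP_least) (auto intro: SUP_upper)
qed

end
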